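(* Suppose $(X,d)$ is a separable, bounded metric space. Then there exists an isometric embedding $\varphi:(X,d)\to(\mathrm{Dgm}_\infty,w_\infty)$. Moreover, if $c>\sup\{d(x,y) : x,y\in X\}$, we may choose $\varphi$ such that $\varphi(X)\subseteq B(\emptyset,\tfrac{3c}{2})\setminus B(\emptyset,c)$, where $B(\emptyset,r)=\{D\in\mathrm{Dgm}_\infty : w_\infty(D,\emptyset)<r\}$.
   Context: Let $\mathbb{R}^2_< = \{(x,y)\in\mathbb{R}^2 : x<y\}$ with metric $d_\infty(a,b)=\|a-b\|_\infty=\max(|a_x-b_x|,|a_y-b_y|)$, and let $\Delta$ be the diagonal in $\mathbb{R}^2$; for $a\in\mathbb{R}^2_<$, $d_\infty(a,\Delta)=\inf_{t\in\Delta}\|a-t\|_\infty=(a_y-a_x)/2$. A persistence diagram is a function $D:I\to\mathbb{R}^2_<$ with $I$ a countable (possibly finite or empty) set; $\emptyset$ denotes the diagram with empty index set (and its class). A partial matching between $D_1:I_1\to\mathbb{R}^2_<$ and $D_2:I_2\to\mathbb{R}^2_<$ is a triple $(I_1',I_2',f)$ with $I_1'\subseteq I_1$, $I_2'\subseteq I_2$ and $f:I_1'\to I_2'$ a bijection. Its $\infty$-cost is $$\mathrm{cost}_\infty(f)=\max\Big\{\sup_{i\in I_1'}d_\infty(D_1(i),D_2(f(i))),\ \sup_{i\in I_1\setminus I_1'}d_\infty(D_1(i),\Delta),\ \sup_{i\in I_2\setminus I_2'}d_\infty(D_2(i),\Delta)\Big\}\in[0,\infty]$$ (suprema over empty sets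 are $0$). Put $\tilde w_\infty(D_1,D_2)=\inf\{\mathrm{cost}_\infty(f)\}$ over all partial matchings between $D_1$ and $D_2$. The space $(\mathrm{Dgm}_\infty,w_\infty)$ is the set of persistence diagrams $D$ with $\tilde w_\infty(D,\emptyset)<\infty$, modulo the relation $D_1\sim D_2$ iff $\tilde w_\infty(D_1,D_2)=0$, with the induced metric $w_\infty$ (the bottleneck distance). An isometric embedding is a distance-preserving map (not required to be surjective). *)

theory Defs
  imports "HOL-Analysis.Analysis"
begin

definition half_plane :: "(real \<times> real) set" where
  "half_plane = {(x, y). x < y}"

definition diagonal :: "(real \<times> real) set" where
  "diagonal = {(x, y). x = y}"

text \<open>The library metric on \<^typ>\<open>real \<times> real\<close> is Euclidean, so the maximum metric is defined here.\<close>

definition d_infty :: "real \<times> real \<Rightarrow> real \<times> real \<Rightarrow> real" where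
  "d_infty a b = max \<bar>fst a - fst b\<bar> \<bar>snd a - snd b\<bar>"

definition d_diag :: "real \<times> real \<Rightarrow> real" where
  "d_diag a = (INF t\<in>diagonal. d_infty a t)"

text \<open>A diagram is given by its index set and a total function, whose values outside the index set
  are irrelevant.\<close>

type_synonym 'i diagram = "'i set \<times> ('i \<Rightarrow> real \<times> real)"

fun persistence_diagram :: "'i diagram \<Rightarrow> bool" where
  "persistence_diagram (I, p) \<longleftrightarrow> countable I \<and> p \<in> I \<rightarrow> half_plane"

definition empty_diagram :: "'i diagram" where
  "empty_diagram = ({}, \<lambda>_. undefined)"

fun partial_matching ::
  "'i diagram \<Rightarrow> 'j diagram \<Rightarrow> 'i set \<times> 'j set \<times> ('i \<Rightarrow> 'j) \<Rightarrow> bool" where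
  "partial_matching (I1, p1) (I2, p2) (J1, J2, f) \<longleftrightarrow> J1 \<subseteq> I1 \<and> J2 \<subseteq> I2 \<and> bij_betw f J1 J2"

text \<open>Suprema are taken in \<^typ>\<open>ennreal\<close>, where the supremum of the empty set is \<open>0\<close>.\<close>

fun cost_infty ::
  "'i diagram \<Rightarrow> 'j diagram \<Rightarrow> 'i set \<times> 'j set \<times> ('i \<Rightarrow> 'j) \<Rightarrow> ennreal" where
  "cost_infty (I1, p1) (I2, p2) (J1, J2, f) =
     Max {SUP i\<in>J1. ennreal (d_infty (p1 i) (p2 (f i))),
          SUP i\<in>I1 - J1. ennreal (d_diag (p1 i)),
          SUP i\<in>I2 - J2. ennreal (d_diag (p2 i))}"

definition w_tilde :: "'i diagram \<Rightarrow> 'j diagram \<Rightarrow> ennreal" where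
  "w_tilde D1 D2 = (INF m\<in>{m. partial_matching D1 D2 m}. cost_infty D1 D2 m)"

lemma d_infty_nonneg: "0 \<le> d_infty a b"
  by (simp add: d_infty_def)

lemma d_infty_self [simp]: "d_infty a a = 0"
  by (simp add: d_infty_def)

lemma d_infty_commute: "d_infty a b = d_infty b a"
  by (simp add: d_infty_def abs_minus_commute)

lemma d_infty_le_iff: "d_infty a b \<le> r \<longleftrightarrow> \<bar>fst a - fst b\<bar> \<le> r \<and> \<bar>snd a - snd b\<bar> \<le> r"
  by (simp add: d_infty_def)

lemma d_infty_triangle: "d_infty a c \<le> d_infty a b + d_infty b c"
  using d_infty_le_iff[of a b "d_infty a b"] d_infty_le_iff[of b c "d_infty b c"]
  unfolding d_infty_le_iff[of a c] by linarith

lemma d_diag_eq: "d_diag (x, y) = \<bar>y - x\<bar> / 2"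
  unfolding d_diag_def
proof (rule cInf_eq_minimum)
  define h where "h = (y - x) / 2"
  have y: "y = x + 2 * h" by (simp add: h_def field_simps)
  have "d_infty (x, y) (x + h, x + h) = \<bar>h\<bar>"
    by (simp add: d_infty_def y)
  then show "\<bar>y - x\<bar> / 2 \<in> d_infty (x, y) ` diagonal"
    by (intro image_eqI[where x = "(x + h, x + h)"]) (auto simp: diagonal_def y)
next
  fix r assume "r \<in> d_infty (x, y) ` diagonal"
  then obtain t where r: "r = d_infty (x, y) (t, t)"
    by (auto simp: diagonal_def)
  have "\<bar>x - t\<bar> \<le> r" "\<bar>y - t\<bar> \<le> r"
    using d_infty_le_iff[of "(x, y)" "(t, t)" r] r by simp_all
  then have "\<bar>y - x\<bar> \<le> 2 * r" by linarith
  then show "\<bar>y - x\<bar> / 2 \<le> r" by simp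
qed

lemma d_diag_nonneg: "0 \<le> d_diag a"
  by (cases a) (simp add: d_diag_eq)

lemma d_diag_triangle: "d_diag a \<le> d_infty a b + d_diag b"
proof -
  obtain x y u v where ab: "a = (x, y)" "b = (u, v)" by (cases a, cases b)
  have "\<bar>x - u\<bar> \<le> d_infty a b" "\<bar>y - v\<bar> \<le> d_infty a b"
    using d_infty_le_iff[of a b "d_infty a b"] by (simp_all add: ab)
  then have "\<bar>y - x\<bar> \<le> 2 * d_infty a b + \<bar>v - u\<bar>" by linarith
  then show ?thesis by (simp add: ab d_diag_eq)
qed

lemma cost_infty_le_iff:
  "cost_infty (I1, p1) (I2, p2) (J1, J2, f) \<le> r \<longleftrightarrow>
     (\<forall>i\<in>J1. ennreal (d_infty (p1 i) (p2 (f i))) \<le> r) \<and>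
     (\<forall>i\<in>I1 - J1. ennreal (d_diag (p1 i)) \<le> r) \<and>
     (\<forall>i\<in>I2 - J2. ennreal (d_diag (p2 i)) \<le> r)"
  by (simp add: SUP_le_iff)

declare cost_infty.simps [simp del]

lemma cost_inftyD:
  assumes "cost_infty (I1, p1) (I2, p2) (J1, J2, f) \<le> r"
  shows "i \<in> J1 \<Longrightarrow> ennreal (d_infty (p1 i) (p2 (f i))) \<le> r"
    and "i \<in> I1 \<Longrightarrow> i \<notin> J1 \<Longrightarrow> ennreal (d_diag (p1 i)) \<le> r"
    and "j \<in> I2 \<Longrightarrow> j \<notin> J2 \<Longrightarrow> ennreal (d_diag (p2 j)) \<le> r"
  using cost_infty_le_iff[of I1 p1 I2 p2 J1 J2 f r] assms by blast+

lemma w_tilde_le: "partial_matching D1 D2 m \<Longrightarrow> w_tilde D1 D2 \<le> cost_infty D1 D2 m"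
  unfolding w_tilde_def by (rule INF_lower) simp

lemma w_tilde_self [simp]: "w_tilde D D = 0"
proof -
  obtain I p where D: "D = (I, p)" by (cases D)
  have "cost_infty D D (I, I, id) \<le> 0"
    unfolding D cost_infty_le_iff by simp
  moreover have "partial_matching D D (I, I, id)" by (simp add: D)
  ultimately have "w_tilde D D \<le> 0" using w_tilde_le order_trans by blast
  then show ?thesis by simp
qed

lemma w_tilde_commute_le: "w_tilde D2 D1 \<le> w_tilde D1 D2"
proof -
  obtain I1 p1 I2 p2 where D: "D1 = (I1, p1)" "D2 = (I2, p2)" by (cases D1, cases D2)
  have "w_tilde D2 D1 \<le> cost_infty D1 D2 m" if m: "partial_matching D1 D2 m" for m
  proof -
    obtain J1 J2 f where [simp]: "m = (J1, J2, f)" by (cases m)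
    have J: "J1 \<subseteq> I1" "J2 \<subseteq> I2" "bij_betw f J1 J2" using m by (auto simp: D)
    let ?g = "inv_into J1 f"
    have pm: "partial_matching D2 D1 (J2, J1, ?g)"
      using J by (simp add: D bij_betw_inv_into)
    have "cost_infty D2 D1 (J2, J1, ?g) \<le> cost_infty D1 D2 m"
      unfolding D cost_infty_le_iff
    proof (intro conjI ballI)
      fix i assume i: "i \<in> J2"
      then have "f (?g i) = i" "?g i \<in> J1"
        using J(3) by (auto simp: bij_betw_inv_into_right bij_betw_def inv_into_into)
      with cost_inftyD(1)[OF order_refl, of "?g i" J1 p1 p2 f I1 I2 J2]
      show "ennreal (d_infty (p2 i) (p1 (?g i))) \<le> cost_infty (I1, p1) (I2, p2) m"
        by (simp add: d_infty_commute)
    qed (auto intro: cost_inftyD[OF order_refl])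
    then show ?thesis using w_tilde_le[OF pm] by (rule order_trans[rotated])
  qed
  then show ?thesis unfolding w_tilde_def[of D1] by (auto intro: INF_greatest)
qed

lemma w_tilde_commute: "w_tilde D1 D2 = w_tilde D2 D1"
  by (intro antisym w_tilde_commute_le)

lemma w_tilde_le_cost_add:
  assumes "partial_matching D1 D2 m" "partial_matching D2 D3 n"
  shows "w_tilde D1 D3 \<le> cost_infty D1 D2 m + cost_infty D2 D3 n"
proof -
  obtain I1 p1 I2 p2 I3 p3 where D: "D1 = (I1, p1)" "D2 = (I2, p2)" "D3 = (I3, p3)"
    by (cases D1, cases D2, cases D3)
  obtain A B f B' C g where mn: "m = (A, B, f)" "n = (B', C, g)" by (cases m, cases n)
  have f: "A \<subseteq> I1" "B \<subseteq> I2" "inj_on f A" "f ` A = B"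
    and g: "B' \<subseteq> I2" "C \<subseteq> I3" "inj_on g B'" "g ` B' = C"
    using assms by (auto simp: D mn bij_betw_def)
  define K where "K = {i \<in> A. f i \<in> B'}"
  define r s where "r = cost_infty D1 D2 m" and "s = cost_infty D2 D3 n"
  note r = cost_inftyD[OF eq_refl, OF r_def[unfolded D mn, symmetric]]
  note s = cost_inftyD[OF eq_refl, OF s_def[unfolded D mn, symmetric]]
  have add: "ennreal x \<le> r + s"
    if "x \<le> y + z" "ennreal y \<le> r" "ennreal z \<le> s" "0 \<le> y" "0 \<le> z" for x y z
  proof -
    have "ennreal x \<le> ennreal (y + z)" using that(1) by (rule ennreal_leI)
    also have "\<dots> = ennreal y + ennreal z" using that by simp
    also have "\<dots> \<le> r + s" using that by (intro add_mono)
    finally show ?thesis .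
  qed
  have "inj_on (g \<circ> f) K"
    using f g by (auto simp: K_def inj_on_def)
  then have pm: "partial_matching D1 D3 (K, (g \<circ> f) ` K, g \<circ> f)"
    using f g by (auto simp: D K_def bij_betw_def)
  have "cost_infty D1 D3 (K, (g \<circ> f) ` K, g \<circ> f) \<le> r + s"
    unfolding D cost_infty_le_iff
  proof (intro conjI ballI)
    fix i assume "i \<in> K"
    then have "i \<in> A" "f i \<in> B'" by (auto simp: K_def)
    then show "ennreal (d_infty (p1 i) (p3 ((g \<circ> f) i))) \<le> r + s"
      using d_infty_triangle[of "p1 i" "p3 (g (f i))" "p2 (f i)"] r(1) s(1)
      by (auto intro!: add[OF _ _ _ d_infty_nonneg d_infty_nonneg])
  next
    fix i assume i: "i \<in> I1 - K"
    show "ennreal (d_diag (p1 i)) \<le> r + s"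
    proof (cases "i \<in> A")
      case True
      then have "f i \<in> I2" "f i \<notin> B'" using i f by (auto simp: K_def)
      then show ?thesis
        using d_diag_triangle[of "p1 i" "p2 (f i)"] r(1) s(2) True
        by (auto intro!: add[OF _ _ _ d_infty_nonneg d_diag_nonneg])
    next
      case False
      then show ?thesis using r(2)[of i] i by (simp add: add_increasing2)
    qed
  next
    fix k assume k: "k \<in> I3 - (g \<circ> f) ` K"
    show "ennreal (d_diag (p3 k)) \<le> r + s"
    proof (cases "k \<in> C")
      case True
      then obtain j where j: "j \<in> B'" "k = g j" using g by auto
      then have "j \<notin> B" using k f by (auto simp: K_def)
      have "d_diag (p3 k) \<le> d_diag (p2 j) + d_infty (p2 j) (p3 (g j))"
        using d_diag_triangle[of "p3 k" "p2 j"] j by (simp add: d_infty_commute)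
      then show ?thesis
        using r(3)[of j] s(1)[of j] j g \<open>j \<notin> B\<close>
        by (auto intro!: add[OF _ _ _ d_diag_nonneg d_infty_nonneg])
    next
      case False
      then show ?thesis using s(3)[of k] k by (simp add: add_increasing)
    qed
  qed
  then show ?thesis
    using w_tilde_le[OF pm] unfolding r_def s_def by (rule order_trans[rotated])
qed

lemma w_tilde_triangle: "w_tilde D1 D3 \<le> w_tilde D1 D2 + w_tilde D2 D3"
proof (rule ennreal_le_epsilon)
  fix e :: real
  assume fin: "w_tilde D1 D2 + w_tilde D2 D3 < top" and e: "0 < e"
  have e2: "0 < ennreal (e / 2)" using e by simp
  have "w_tilde D1 D2 < w_tilde D1 D2 + ennreal (e / 2)"
    "w_tilde D2 D3 < w_tilde D2 D3 + ennreal (e / 2)"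
    using fin e2 ennreal_add_left_cancel_less[of "w_tilde D1 D2" 0 "ennreal (e / 2)"]
      ennreal_add_left_cancel_less[of "w_tilde D2 D3" 0 "ennreal (e / 2)"]
    by (simp_all add: less_top)
  then obtain m n where
    mn: "partial_matching D1 D2 m" "cost_infty D1 D2 m < w_tilde D1 D2 + ennreal (e / 2)"
      "partial_matching D2 D3 n" "cost_infty D2 D3 n < w_tilde D2 D3 + ennreal (e / 2)"
    unfolding w_tilde_def INF_less_iff by auto
  have "w_tilde D1 D3 \<le> cost_infty D1 D2 m + cost_infty D2 D3 n"
    using mn by (intro w_tilde_le_cost_add)
  also have "\<dots> \<le> (w_tilde D1 D2 + ennreal (e / 2)) + (w_tilde D2 D3 + ennreal (e / 2))"
    using mn by (intro add_mono) auto
  also have "\<dots> = w_tilde D1 D2 + w_tilde D2 D3 + (ennreal (e / 2) + ennreal (e / 2))"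
    by (simp add: ac_simps)
  also have "ennreal (e / 2) + ennreal (e / 2) = ennreal e"
    using e by (simp flip: ennreal_plus)
  finally show "w_tilde D1 D3 \<le> w_tilde D1 D2 + w_tilde D2 D3 + ennreal e" .
qed

text \<open>Every diagram over a countable index set is at distance \<open>0\<close> from one indexed by a set of
  natural numbers, so it is no restriction to build the space of diagrams from index sets in
  \<^typ>\<open>nat\<close>.\<close>

lemma persistence_diagram_nat_index:
  assumes "persistence_diagram D"
  shows "\<exists>D' :: nat diagram. persistence_diagram D' \<and> w_tilde D D' = 0"
proof -
  obtain I p where D: "D = (I, p)" by (cases D)
  have I: "countable I" "p \<in> I \<rightarrow> half_plane" using assms by (auto simp: D)
  let ?f = "to_nat_on I"
  let ?D' = "(?f ` I, p \<circ> from_nat_into I)"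
  have "partial_matching D ?D' (I, ?f ` I, ?f)"
    using I by (simp add: D inj_on_imp_bij_betw inj_on_to_nat_on)
  moreover have "cost_infty D ?D' (I, ?f ` I, ?f) \<le> 0"
    unfolding D cost_infty_le_iff using I by simp
  ultimately have "w_tilde D ?D' \<le> 0" using w_tilde_le order_trans by blast
  moreover have "persistence_diagram ?D'" using I by auto
  ultimately show ?thesis by (intro exI[of _ ?D']) simp
qed

definition finite_distance_diagram :: "nat diagram \<Rightarrow> bool" where
  "finite_distance_diagram D \<longleftrightarrow>
     persistence_diagram D \<and> w_tilde D (empty_diagram :: nat diagram) < \<infinity>"

definition diagram_equiv :: "nat diagram \<Rightarrow> nat diagram \<Rightarrow> bool" where
  "diagram_equiv D1 D2 \<longleftrightarrow> finite_distance_diagram D1 \<and> finite_distance_diagram D2 \<and> w_tilde D1 D2 = 0"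

lemma finite_distance_diagram_empty: "finite_distance_diagram empty_diagram"
  by (simp add: finite_distance_diagram_def) (simp add: empty_diagram_def)

lemma w_tilde_finite:
  assumes "finite_distance_diagram D1" "finite_distance_diagram D2"
  shows "w_tilde D1 D2 < \<infinity>"
proof -
  have "w_tilde D1 D2 \<le> w_tilde D1 (empty_diagram :: nat diagram) + w_tilde (empty_diagram :: nat diagram) D2"
    by (rule w_tilde_triangle)
  also have "\<dots> < \<infinity>"
    using assms by (simp add: finite_distance_diagram_def w_tilde_commute[of empty_diagram D2])
  finally show ?thesis .
qed

lemma part_equivp_diagram_equiv: "part_equivp diagram_equiv"
proof (rule part_equivpI)
  show "\<exists>D. diagram_equiv D D"
    using finite_distance_diagram_empty by (intro exI[of _ empty_diagram]) (simp add: diagram_equiv_def)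
  show "symp diagram_equiv"
  proof (rule sympI)
    fix D1 D2 assume "diagram_equiv D1 D2"
    then show "diagram_equiv D2 D1"
      unfolding diagram_equiv_def w_tilde_commute[of D2 D1] by simp
  qed
  show "transp diagram_equiv"
  proof (rule transpI)
    fix D1 D2 D3 assume "diagram_equiv D1 D2" "diagram_equiv D2 D3"
    then show "diagram_equiv D1 D3"
      using w_tilde_triangle[of D1 D3 D2] by (simp add: diagram_equiv_def)
  qed
qed

quotient_type Dgm_infty = "nat diagram" / partial: diagram_equiv
  by (rule part_equivp_diagram_equiv)

lift_definition empty_Dgm :: Dgm_infty is empty_diagram
  by (simp add: diagram_equiv_def finite_distance_diagram_empty)

lift_definition w_infty :: "Dgm_infty \<Rightarrow> Dgm_infty \<Rightarrow> real" is "\<lambda>D1 D2. enn2real (w_tilde D1 D2)"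
proof -
  fix D1 D1' D2 D2'
  assume e: "diagram_equiv D1 D1'" "diagram_equiv D2 D2'"
  have "w_tilde D1 D2 \<le> w_tilde D1 D1' + (w_tilde D1' D2' + w_tilde D2' D2)"
    by (rule order_trans[OF w_tilde_triangle add_left_mono[OF w_tilde_triangle]])
  moreover have "w_tilde D1' D2' \<le> w_tilde D1' D1 + (w_tilde D1 D2 + w_tilde D2 D2')"
    by (rule order_trans[OF w_tilde_triangle add_left_mono[OF w_tilde_triangle]])
  ultimately show "enn2real (w_tilde D1 D2) = enn2real (w_tilde D1' D2')"
    using e by (simp add: diagram_equiv_def w_tilde_commute[of D1' D1] w_tilde_commute[of D2' D2])
qed

interpretation Dgm: Metric_space UNIV w_infty
proof
  fix x y z :: Dgm_infty
  show "0 \<le> w_infty x y" by transfer simp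
  show "w_infty x y = w_infty y x" by transfer (rule arg_cong[OF w_tilde_commute])
  show "w_infty x y = 0 \<longleftrightarrow> x = y"
  proof transfer
    fix D1 D2 assume "diagram_equiv D1 D1" "diagram_equiv D2 D2"
    then show "enn2real (w_tilde D1 D2) = 0 \<longleftrightarrow> diagram_equiv D1 D2"
      using w_tilde_finite[of D1 D2] by (auto simp: diagram_equiv_def enn2real_eq_0_iff)
  qed
  show "w_infty x z \<le> w_infty x y + w_infty y z"
  proof transfer
    fix D1 D2 D3
    assume "diagram_equiv D1 D1" "diagram_equiv D2 D2" "diagram_equiv D3 D3"
    then have "w_tilde D1 D2 < \<infinity>" "w_tilde D2 D3 < \<infinity>"
      by (auto simp: diagram_equiv_def intro!: w_tilde_finite simp del: infinity_ennreal_def)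
    then show "enn2real (w_tilde D1 D3) \<le> enn2real (w_tilde D1 D2) + enn2real (w_tilde D2 D3)"
      using enn2real_mono[OF w_tilde_triangle[of D1 D3 D2]] by (simp add: enn2real_plus)
  qed
qed

definition isometric_embedding ::
  "'a set \<Rightarrow> ('a \<Rightarrow> 'a \<Rightarrow> real) \<Rightarrow> 'b set \<Rightarrow> ('b \<Rightarrow> 'b \<Rightarrow> real) \<Rightarrow> ('a \<Rightarrow> 'b) \<Rightarrow> bool" where
  "isometric_embedding X d Y e \<phi> \<longleftrightarrow> \<phi> \<in> X \<rightarrow> Y \<and> (\<forall>x\<in>X. \<forall>y\<in>X. e (\<phi> x) (\<phi> y) = d x y)"

end

theory Submission
  imports Defs
begin

text \<open>Let \<open>s\<close> enumerate a dense subset of \<open>X\<close> and send \<open>x\<close> to the diagram with points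
  \<open>(2ck, 2c(k + 1) + d x (s k))\<close>. Matching equal indices costs
  \<open>sup\<^sub>k \<bar>d x (s k) - d y (s k)\<bar>\<close>, which is \<open>d x y\<close> by density, as in the Kuratowski embedding.
  Any other choice for an index \<open>k\<close> costs at least \<open>c > d x y\<close>: the points of different indices
  have births at least \<open>2c\<close> apart, and every point has distance at least \<open>c\<close> to the diagonal.\<close>

definition kuratowski_diagram :: "('a \<Rightarrow> 'a \<Rightarrow> real) \<Rightarrow> (nat \<Rightarrow> 'a) \<Rightarrow> real \<Rightarrow> 'a \<Rightarrow> nat diagram" where
  "kuratowski_diagram d s c x = (UNIV, \<lambda>k. (2 * c * real k, 2 * c * (real k + 1) + d x (s k)))"

lemma w_tilde_empty_le:
  fixes I :: "'i set"
  assumes "\<And>i. i \<in> I \<Longrightarrow> d_diag (p i) \<le> r"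
  shows "w_tilde (I, p) (empty_diagram :: 'j diagram) \<le> ennreal r"
proof -
  have "partial_matching (I, p) (empty_diagram :: 'j diagram) ({}, {}, f)" for f
    by (simp add: empty_diagram_def bij_betw_def)
  moreover have "cost_infty (I, p) (empty_diagram :: 'j diagram) ({}, {}, f) \<le> ennreal r" for f
    unfolding empty_diagram_def cost_infty_le_iff using assms by (auto intro: ennreal_leI)
  ultimately show ?thesis using w_tilde_le order_trans by blast
qed

text \<open>The only partial matching with \<open>empty_diagram\<close> is the empty one, so every
  point is unmatched and pays its distance to the diagonal.\<close>

lemma w_tilde_empty_ge:
  fixes I :: "'i set"
  assumes "i \<in> I"
  shows "ennreal (d_diag (p i)) \<le> w_tilde (I, p) (empty_diagram :: 'j diagram)"
  unfolding w_tilde_def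
proof (rule INF_greatest, clarify)
  fix J1 :: "'i set" and J2 :: "'j set" and f
  assume "partial_matching (I, p) (empty_diagram :: 'j diagram) (J1, J2, f)"
  then have "J1 = {}" by (auto simp: empty_diagram_def bij_betw_def)
  with assms show "ennreal (d_diag (p i)) \<le> cost_infty (I, p) (empty_diagram :: 'j diagram) (J1, J2, f)"
    unfolding empty_diagram_def by (intro cost_inftyD(2)[OF order_refl]) auto
qed

context Metric_space
begin

text \<open>A nonempty countable set is the range of a sequence on all of \<open>nat\<close>. Values
  repeat if the set is finite, which is harmless: diagram points are separated by index.\<close>

lemma separable_dense_sequence:
  assumes "separable_space mtopology" "M \<noteq> {}"
  obtains s :: "nat \<Rightarrow> 'a" where "range s \<subseteq> M"
    and "\<And>x e. x \<in> M \<Longrightarrow> 0 < e \<Longrightarrow> \<exists>k. d x (s k) < e"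
proof -
  obtain C where C: "countable C" "C \<subseteq> M" "mtopology closure_of C = M"
    using assms(1) by (auto simp: separable_space_def)
  then have "C \<noteq> {}" using assms(2) by auto
  then have range: "range (from_nat_into C) = C"
    using C(1) by (rule range_from_nat_into)
  show ?thesis
  proof
    show "range (from_nat_into C) \<subseteq> M" using range C(2) by simp
  next
    fix x e assume "x \<in> M" and e: "0 < (e :: real)"
    then have "x \<in> mtopology closure_of C" using C(3) by simp
    then obtain y where y: "y \<in> C" "d x y < e"
      using e by (auto simp: metric_closure_of in_mball)
    then obtain k where "y = from_nat_into C k" using range by (metis imageE)
    then show "\<exists>k. d x (from_nat_into C k) < e" using y by auto
  qed
qed

text \<open>Under the identity matching births agree and the shifts by \<open>c\<close> cancel in
  the deaths, so the reverse triangle inequality suffices, whatever \<open>c\<close> is.\<close>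

lemma w_tilde_kuratowski_diagram_le:
  assumes "range s \<subseteq> M" "x \<in> M" "y \<in> M"
  shows "w_tilde (kuratowski_diagram d s c x) (kuratowski_diagram d s c y) \<le> ennreal (d x y)"
proof -
  let ?D = "kuratowski_diagram d s c"
  have "\<bar>d x (s k) - d y (s k)\<bar> \<le> d x y" for k
  proof -
    have "s k \<in> M" using assms by auto
    then show ?thesis
      using triangle[of x y "s k"] triangle[of y x "s k"] commute[of x y] assms by auto
  qed
  then have "cost_infty (?D x) (?D y) (UNIV, UNIV, id) \<le> ennreal (d x y)"
    unfolding kuratowski_diagram_def cost_infty_le_iff
    by (auto intro!: ennreal_leI simp: d_infty_le_iff)
  moreover have "partial_matching (?D x) (?D y) (UNIV, UNIV, id)"
    by (simp add: kuratowski_diagram_def)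
  ultimately show ?thesis using w_tilde_le order_trans by blast
qed

text \<open>One index \<open>k\<close> with \<open>s k\<close> near \<open>x\<close> already forces
  the cost up, so density is only asked at \<open>x\<close>.\<close>

lemma w_tilde_kuratowski_diagram_ge:
  assumes s: "range s \<subseteq> M" and dense: "\<And>e. 0 < e \<Longrightarrow> \<exists>k. d x (s k) < e"
    and xy: "x \<in> M" "y \<in> M" and c: "d x y \<le> c"
  shows "ennreal (d x y) \<le> w_tilde (kuratowski_diagram d s c x) (kuratowski_diagram d s c y)"
  unfolding w_tilde_def
proof (rule INF_greatest, clarify)
  fix J1 J2 f
  let ?D = "kuratowski_diagram d s c"
  define p where "p z = (\<lambda>k. (2 * c * real k, 2 * c * (real k + 1) + d z (s k)))" for z
  have D: "?D z = (UNIV, p z)" for z by (simp add: kuratowski_diagram_def p_def)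
  let ?r = "cost_infty (?D x) (?D y) (J1, J2, f)"
  have c0: "0 \<le> c" using c nonneg[of x y] by linarith
  show "ennreal (d x y) \<le> ?r"
  proof (rule ennreal_le_epsilon)
    fix e :: real assume e: "0 < e"
    \<comment> \<open>Half of \<open>e\<close>, since \<open>d x (s k)\<close> is lost twice:
      \<open>d x y \<le> \<bar>d x (s k) - d y (s k)\<bar> + 2 * d x (s k)\<close>.\<close>
    obtain k where k: "d x (s k) < e / 2" using dense[of "e / 2"] e by auto
    have sk: "s k \<in> M" using s by auto
    \<comment> \<open>Here \<open>b\<close> is the price paid for index \<open>k\<close>: its
      distance to the diagonal or to its partner.\<close>
    have "\<exists>b. ennreal b \<le> ?r \<and> d x y \<le> b + e"
    proof (cases "k \<in> J1")
      case False
      then have "ennreal (d_diag (p x k)) \<le> ?r"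
        unfolding D by (intro cost_inftyD(2)[OF order_refl]) auto
      moreover have "c \<le> d_diag (p x k)"
        using c0 nonneg[of x "s k"] by (simp add: p_def d_diag_eq algebra_simps)
      ultimately show ?thesis using c e by (intro exI[of _ "d_diag (p x k)"]) auto
    next
      case True
      then have r: "ennreal (d_infty (p x k) (p y (f k))) \<le> ?r"
        unfolding D by (intro cost_inftyD(1)[OF order_refl]) auto
      have "d x y \<le> d_infty (p x k) (p y (f k)) + e"
      proof (cases "f k = k")
        case True
        have "\<bar>d x (s k) - d y (s k)\<bar> \<le> d_infty (p x k) (p y (f k))"
          by (simp add: True p_def d_infty_def)
        then show ?thesis
          using triangle[of x "s k" y] commute[of "s k" y] xy sk k by auto
      next
        case False
        have "1 \<le> \<bar>real k - real (f k)\<bar>" using False by linarith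
        then have "2 * c \<le> 2 * c * \<bar>real k - real (f k)\<bar>"
          using mult_left_mono[of 1 "\<bar>real k - real (f k)\<bar>" "2 * c"] c0 by simp
        also have "\<dots> = \<bar>2 * c * real k - 2 * c * real (f k)\<bar>"
          using c0 by (simp add: abs_mult flip: right_diff_distrib)
        also have "\<dots> \<le> d_infty (p x k) (p y (f k))"
          by (simp add: p_def d_infty_def)
        finally show ?thesis using c c0 e by linarith
      qed
      with r show ?thesis by blast
    qed
    then obtain b where b: "ennreal b \<le> ?r" "d x y \<le> b + e" by blast
    \<comment> \<open>The sign of \<open>b\<close> is no longer known, and \<open>ennreal\<close>
      truncates negative reals to \<open>0\<close>; hence the \<open>max\<close>.\<close>
    have "ennreal (d x y) \<le> ennreal (max 0 b + e)"
      using b(2) by (intro ennreal_leI) auto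
    also have "\<dots> = ennreal b + ennreal e"
      using e by (subst ennreal_plus) (auto simp: max_def ennreal_neg)
    also have "\<dots> \<le> ?r + ennreal e" using b(1) by (rule add_right_mono)
    finally show "ennreal (d x y) \<le> ?r + ennreal e" .
  qed
qed

text \<open>Each point of the diagram of \<open>z\<close> is at distance
  \<open>c + d z (s k) / 2\<close> from the diagonal, which lies between \<open>c\<close> and
  \<open>c + S / 2\<close>. The gap \<open>S < c\<close> makes the outer bound strict.\<close>

lemma bottleneck_embedding:
  assumes sep: "separable_space mtopology"
    and diam: "\<And>x y. x \<in> M \<Longrightarrow> y \<in> M \<Longrightarrow> d x y \<le> S" and c: "S < c"
  shows "\<exists>\<phi>. isometric_embedding M d UNIV w_infty \<phi> \<and>
    \<phi> ` M \<subseteq> Dgm.mball empty_Dgm (3 * c / 2) - Dgm.mball empty_Dgm c"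
proof (cases "M = {}")
  \<comment> \<open>Without points there is no sequence \<open>s\<close> and \<open>c\<close> may be
    negative, but any map will do.\<close>
  case True
  then show ?thesis by (simp add: isometric_embedding_def)
next
  case False
  then obtain x0 where "x0 \<in> M" by auto
  then have "0 \<le> S" using diam[of x0 x0] nonneg[of x0 x0] by linarith
  then have c0: "0 < c" using c by linarith
  obtain s :: "nat \<Rightarrow> 'a" where s: "range s \<subseteq> M" "\<And>x e. x \<in> M \<Longrightarrow> 0 < e \<Longrightarrow> \<exists>k. d x (s k) < e"
    using separable_dense_sequence[OF sep False] by blast
  let ?D = "kuratowski_diagram d s c"
  define p where "p z = (\<lambda>k. (2 * c * real k, 2 * c * (real k + 1) + d z (s k)))" for z
  have D: "?D z = (UNIV, p z)" for z by (simp add: kuratowski_diagram_def p_def)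
  have diag: "d_diag (p z k) = c + d z (s k) / 2" for z k
    using c0 nonneg[of z "s k"] by (simp add: p_def d_diag_eq field_simps)
  have le: "w_tilde (?D z) (empty_diagram :: nat diagram) \<le> ennreal (c + S / 2)" if "z \<in> M" for z
    unfolding D using that s(1) by (intro w_tilde_empty_le) (auto simp: diag intro!: diam)
  have ge: "ennreal c \<le> w_tilde (?D z) (empty_diagram :: nat diagram)" for z
  proof -
    have "ennreal c \<le> ennreal (d_diag (p z 0))"
      using nonneg by (intro ennreal_leI) (simp add: diag)
    also have "\<dots> \<le> w_tilde (?D z) (empty_diagram :: nat diagram)"
      unfolding D by (intro w_tilde_empty_ge) simp
    finally show ?thesis .
  qed
  have "persistence_diagram (?D z)" for z
    using c0 by (auto simp: D p_def half_plane_def algebra_simps add_nonneg_pos)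
  then have fin: "diagram_equiv (?D z) (?D z)" if "z \<in> M" for z
    using le_less_trans[OF le[OF that] ennreal_less_top]
    by (simp add: diagram_equiv_def finite_distance_diagram_def)
  have empty: "diagram_equiv empty_diagram empty_diagram"
    by (simp add: diagram_equiv_def finite_distance_diagram_empty)
  define \<phi> where "\<phi> = abs_Dgm_infty \<circ> ?D"
  have "w_infty (\<phi> x) (\<phi> y) = d x y" if "x \<in> M" "y \<in> M" for x y
  proof -
    have "w_tilde (?D x) (?D y) = ennreal (d x y)"
      using that c diam[of x y] s
      by (intro antisym w_tilde_kuratowski_diagram_le w_tilde_kuratowski_diagram_ge) auto
    then show ?thesis by (simp add: \<phi>_def w_infty.abs_eq fin that)
  qed
  moreover have "c \<le> w_infty empty_Dgm (\<phi> x)" "w_infty empty_Dgm (\<phi> x) < 3 * c / 2"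
    if "x \<in> M" for x
  proof -
    let ?w = "w_tilde (?D x) (empty_diagram :: nat diagram)"
    have w: "w_infty empty_Dgm (\<phi> x) = enn2real ?w"
      by (simp add: \<phi>_def empty_Dgm.abs_eq w_infty.abs_eq fin empty that
          w_tilde_commute[of empty_diagram])
    \<comment> \<open>Finiteness comes first because \<open>enn2real\<close> sends
      \<open>top\<close> to \<open>0\<close>, which would break the lower bound.\<close>
    have "?w < top" using le[OF that] ennreal_less_top by (rule le_less_trans)
    then show "c \<le> w_infty empty_Dgm (\<phi> x)"
      using enn2real_mono[OF ge[of x]] c0 by (simp add: w)
    have "enn2real ?w \<le> c + S / 2"
      using le[OF that] \<open>0 \<le> S\<close> c0 by (intro enn2real_leI) auto
    then show "w_infty empty_Dgm (\<phi> x) < 3 * c / 2" using c by (simp add: w)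
  qed
  ultimately show ?thesis
    by (intro exI[of _ \<phi>]) (force simp: isometric_embedding_def Dgm.in_mball)
qed

end

theorem theorem19:
  fixes X :: "'a set" and d :: "'a \<Rightarrow> 'a \<Rightarrow> real"
  assumes "Metric_space X d"
    and "separable_space (Metric_space.mtopology X d)"
    and "Metric_space.mbounded X d X"
  shows "(\<exists>\<phi>. isometric_embedding X d UNIV w_infty \<phi>) \<and>
    (\<forall>c::real. c > Sup {d x y | x y. x \<in> X \<and> y \<in> X} \<longrightarrow>
      (\<exists>\<phi>. isometric_embedding X d UNIV w_infty \<phi> \<and>
        \<phi> ` X \<subseteq> Dgm.mball empty_Dgm (3 * c / 2) - Dgm.mball empty_Dgm c))"
proof -
  interpret Metric_space X d by fact
  let ?S = "Sup {d x y | x y. x \<in> X \<and> y \<in> X}"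
  obtain B where "\<And>x y. x \<in> X \<Longrightarrow> y \<in> X \<Longrightarrow> d x y \<le> B"
    using assms(3) by (auto simp: mbounded_alt)
  \<comment> \<open>A real \<open>Sup\<close> is only known to dominate sets that are bounded
    above.\<close>
  then have "bdd_above {d x y | x y. x \<in> X \<and> y \<in> X}"
    by (intro bdd_aboveI[of _ B]) auto
  then have "d x y \<le> ?S" if "x \<in> X" "y \<in> X" for x y
    using that by (intro cSup_upper) auto
  note embed = bottleneck_embedding[OF assms(2) this]
  \<comment> \<open>Any constant above \<open>?S\<close> yields the plain embedding;
    \<open>?S + 1\<close> is one.\<close>
  show ?thesis
    using embed[of "?S + 1"] embed by auto
qed

end
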